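(* Let $M$ be a smooth $n$-dimensional manifold and let $L=L(p,\mathbf v)$ be a smooth function on the tangent bundle $TM$ such that the Legendre map of $L$ is invertible with smooth inverse, the matrix $\mu_{ij}=\frac12\,\frac{\partial^2 L}{\partial v^i\,\partial v^j}$ is positive definite at every point of $TM$, and $\Omega=\sum_{i=1}^n v^i\,\frac{\partial L}{\partial v^i}>0$ whenever $\mathbf v\neq 0$. Then the modified Lagrangian dynamical system $$\dot x^i=\frac{v^i}{\Omega},\qquad \frac{d}{dt}\left(\frac{\partial L}{\partial v^i}\right)=\frac{1}{\Omega}\,\frac{\partial L}{\partial x^i},\qquad i=1,\dots,n,$$ satisfies the weak normality condition with respect to the deviation functions $\varphi=\sum_{i=1}^n\frac{\partial L}{\partial v^i}\,\tau^i$ determined by $L$. That is, for each trajectory of this system there are functions $\mathcal A(t)$ and $\mathcal B(t)$, depending only on the choice of the trajectory, such that for every variation vector $\boldsymbol\tau$ on this trajectory the corresponding deviation function $\varphi(t)$ satisfies $$\ddot\varphi=\mathcal A(t)\,\dot\varphi+\mathcal B(t)\,\varphi .$$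
   Context: No Riemannian metric on $M$ is assumed. Local coordinates $x^1,\dots,x^n$ on $M$ induce coordinates $(x^1,\dots,x^n,v^1,\dots,v^n)$ on $TM$. Legendre map: $\lambda:TM\to T^*M$, $\lambda(p,\mathbf v)=(p,\mathbf p)$, where the momentum covector $\mathbf p$ has components $p_i=\partial L/\partial v^i$. Trajectory: a solution $t\mapsto (x(t),\mathbf v(t))\in TM$, $\mathbf v(t)\ne 0$, of the modified Lagrange equations (so both the point $p(t)\in M$ and the vector $\mathbf v(t)\in T_{p(t)}M$ are part of the data; the actual velocity of the point is $\mathbf v/\Omega$). Dots denote derivatives in $t$. Variation vector: include the given trajectory, as the member with parameter value $y=y_0$, in a smooth one-parameter family of trajectories $x^i=x^i(t,y)$, $v^i=v^i(t,y)$ of the same system. The variation vector on the given trajectory corresponding to this family is the vector $\boldsymbol\tau(t)$ with components $\tau^i=\partial x^i/\partial y$ at $y=y_0$. Different families give different variation vectors on the same trajectory. Deviation function: $\varphi(t)=\langle\mathbf p\,|\,\boldsymbol\tau\rangle=\sum_{i=1}^n\frac{\partial L}{\partial v^i}\,\tau^i$, evaluated along the given trajectory. *)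

theory Defs
  imports "HOL-Analysis.Analysis"
begin

text \<open>
  Functions of class \<open>C\<^sup>k\<close> and \<open>C\<^sup>\<infinity>\<close>. On finite-dimensional domains, \<open>C\<^sup>k\<^sup>+\<^sup>1\<close> on an open set means
  differentiable with all directional derivatives of class \<open>C\<^sup>k\<close>.
\<close>

primrec Ck_on :: "nat \<Rightarrow> 'a::euclidean_space set \<Rightarrow> ('a \<Rightarrow> 'b::euclidean_space) \<Rightarrow> bool" where
  "Ck_on 0 S f = continuous_on S f"
| "Ck_on (Suc k) S f =
     ((\<forall>z\<in>S. f differentiable (at z)) \<and> (\<forall>h. Ck_on k S (\<lambda>z. frechet_derivative f (at z) h)))"

definition smooth_on :: "'a::euclidean_space set \<Rightarrow> ('a \<Rightarrow> 'b::euclidean_space) \<Rightarrow> bool" where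
  "smooth_on S f \<longleftrightarrow> (\<forall>k. Ck_on k S f)"


section \<open>Smooth manifolds\<close>

text \<open>
  A chart is a pair of its domain and its coordinate map, whose values outside the domain are
  irrelevant. The manifold is the whole type \<open>'m\<close>; the Hausdorff property and second
  countability are type class constraints in \<open>smooth_atlas\<close>.
\<close>

type_synonym ('p, 'e) chart = "'p set \<times> ('p \<Rightarrow> 'e)"

abbreviation dom_chart :: "('p, 'e) chart \<Rightarrow> 'p set" where
  "dom_chart c \<equiv> fst c"

abbreviation coords :: "('p, 'e) chart \<Rightarrow> 'p \<Rightarrow> 'e" where
  "coords c \<equiv> snd c"

definition image_chart :: "('p, 'e) chart \<Rightarrow> 'e set" where
  "image_chart c = coords c ` dom_chart c"

definition inv_chart :: "('p, 'e) chart \<Rightarrow> 'e \<Rightarrow> 'p" where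
  "inv_chart c = inv_into (dom_chart c) (coords c)"

definition transition :: "('p, 'e) chart \<Rightarrow> ('p, 'e) chart \<Rightarrow> 'e \<Rightarrow> 'e" where
  "transition c c' = coords c' \<circ> inv_chart c"

definition smooth_atlas ::
  "('m::{t2_space,second_countable_topology}, real^'n) chart set \<Rightarrow> bool" where
  "smooth_atlas A \<longleftrightarrow>
     (\<Union>c\<in>A. dom_chart c) = UNIV \<and>
     (\<forall>c\<in>A. open (dom_chart c) \<and> open (image_chart c) \<and>
        homeomorphism (dom_chart c) (image_chart c) (coords c) (inv_chart c)) \<and>
     (\<forall>c\<in>A. \<forall>c'\<in>A. smooth_on (coords c ` (dom_chart c \<inter> dom_chart c')) (transition c c'))"

definition charts_at :: "('m, 'e) chart set \<Rightarrow> 'm \<Rightarrow> ('m, 'e) chart set" where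
  "charts_at A p = {c \<in> A. p \<in> dom_chart c}"


section \<open>Tangent and cotangent bundle\<close>

text \<open>
  A tangent vector or covector at \<open>p\<close> is given by the family of its component columns in all
  charts around \<open>p\<close>, subject to the vector or covector transformation law. Components
  are set to \<open>0\<close> for all other charts, so that equal (co)vectors are equal as functions and
  \<open>\<lambda>_. 0\<close> is the zero (co)vector at every point.
\<close>

type_synonym ('m, 'n) components = "('m, real^'n) chart \<Rightarrow> real^'n"

definition tangent_space :: "('m, real^'n) chart set \<Rightarrow> 'm \<Rightarrow> ('m, 'n) components set" where
  "tangent_space A p = {v.
     (\<forall>c\<in>charts_at A p. \<forall>c'\<in>charts_at A p.
        v c' = frechet_derivative (transition c c') (at (coords c p)) (v c)) \<and>
     (\<forall>c. c \<notin> charts_at A p \<longrightarrow> v c = 0)}"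

definition cotangent_space :: "('m, real^'n) chart set \<Rightarrow> 'm \<Rightarrow> ('m, 'n) components set" where
  "cotangent_space A p = {\<pi>.
     (\<forall>c\<in>charts_at A p. \<forall>c'\<in>charts_at A p. \<forall>h.
        \<pi> c \<bullet> h = \<pi> c' \<bullet> frechet_derivative (transition c c') (at (coords c p)) h) \<and>
     (\<forall>c. c \<notin> charts_at A p \<longrightarrow> \<pi> c = 0)}"

text \<open>
  The sum \<open>\<Sum>i. \<pi>\<^sub>i v\<^sup>i\<close>, computed in some chart; by \<open>pairing_eq\<close> every chart at \<open>p\<close> gives the
  same value.
\<close>

definition pairing ::
  "('m, real^'n) chart set \<Rightarrow> 'm \<Rightarrow> ('m, 'n) components \<Rightarrow> ('m, 'n) components \<Rightarrow> real" where
  "pairing A p \<pi> v = (let c = (SOME c. c \<in> charts_at A p) in \<Sum>i\<in>UNIV. \<pi> c $ i * v c $ i)"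

lemma pairing_eq:
  assumes "\<pi> \<in> cotangent_space A p" "v \<in> tangent_space A p" "c \<in> charts_at A p"
  shows "pairing A p \<pi> v = (\<Sum>i\<in>UNIV. \<pi> c $ i * v c $ i)"
proof -
  define c' where "c' = (SOME c. c \<in> charts_at A p)"
  have c': "c' \<in> charts_at A p"
    unfolding c'_def using assms(3) by (rule someI)
  have "v c' = frechet_derivative (transition c c') (at (coords c p)) (v c)"
    using assms(2,3) c' unfolding tangent_space_def by blast
  then have "\<pi> c' \<bullet> v c' = \<pi> c' \<bullet> frechet_derivative (transition c c') (at (coords c p)) (v c)"
    by (rule arg_cong)
  also have "\<dots> = \<pi> c \<bullet> v c"
    using assms(1,3) c' unfolding cotangent_space_def by (blast intro: sym)
  finally show ?thesis
    unfolding pairing_def Let_def c'_def[symmetric] by (simp add: inner_vec_def)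
qed

definition tangent_bundle :: "('m, real^'n) chart set \<Rightarrow> ('m \<times> ('m, 'n) components) set" where
  "tangent_bundle A = (SIGMA p:UNIV. tangent_space A p)"

definition cotangent_bundle :: "('m, real^'n) chart set \<Rightarrow> ('m \<times> ('m, 'n) components) set" where
  "cotangent_bundle A = (SIGMA p:UNIV. cotangent_space A p)"

text \<open>
  The chart of a bundle \<open>E\<close> induced by a chart \<open>c\<close> of the base: it sends \<open>(p, w)\<close> to the
  coordinates of \<open>p\<close> and the components of \<open>w\<close>.
\<close>

definition bundle_chart ::
  "('m \<times> ('m, 'n) components) set \<Rightarrow> ('m, real^'n) chart
     \<Rightarrow> ('m \<times> ('m, 'n) components, (real^'n) \<times> (real^'n)) chart" where
  "bundle_chart E c = ({(p, w) \<in> E. p \<in> dom_chart c}, \<lambda>(p, w). (coords c p, w c))"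


section \<open>Lagrangian, momentum covector and Legendre map\<close>

definition local_lagrangian ::
  "('m, real^'n) chart set \<Rightarrow> ('m \<times> ('m, 'n) components \<Rightarrow> real) \<Rightarrow> ('m, real^'n) chart
     \<Rightarrow> (real^'n) \<times> (real^'n) \<Rightarrow> real" where
  "local_lagrangian A L c = L \<circ> inv_chart (bundle_chart (tangent_bundle A) c)"

definition smooth_lagrangian ::
  "('m, real^'n) chart set \<Rightarrow> ('m \<times> ('m, 'n) components \<Rightarrow> real) \<Rightarrow> bool" where
  "smooth_lagrangian A L \<longleftrightarrow>
     (\<forall>c\<in>A. smooth_on (image_chart (bundle_chart (tangent_bundle A) c)) (local_lagrangian A L c))"

definition dL_dx ::
  "('m, real^'n) chart set \<Rightarrow> ('m \<times> ('m, 'n) components \<Rightarrow> real) \<Rightarrow> ('m, real^'n) chart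
     \<Rightarrow> 'm \<times> ('m, 'n) components \<Rightarrow> real^'n" where
  "dL_dx A L c = (\<lambda>(p, v). \<chi> i.
     frechet_derivative (local_lagrangian A L c) (at (coords c p, v c)) (axis i 1, 0))"

definition dL_dv ::
  "('m, real^'n) chart set \<Rightarrow> ('m \<times> ('m, 'n) components \<Rightarrow> real) \<Rightarrow> ('m, real^'n) chart
     \<Rightarrow> 'm \<times> ('m, 'n) components \<Rightarrow> real^'n" where
  "dL_dv A L c = (\<lambda>(p, v). \<chi> i.
     frechet_derivative (local_lagrangian A L c) (at (coords c p, v c)) (0, axis i 1))"

definition fibre_hessian ::
  "('m, real^'n) chart set \<Rightarrow> ('m \<times> ('m, 'n) components \<Rightarrow> real) \<Rightarrow> ('m, real^'n) chart
     \<Rightarrow> 'm \<times> ('m, 'n) components \<Rightarrow> real^'n^'n" where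
  "fibre_hessian A L c = (\<lambda>(p, v). \<chi> i j. 1/2 *
     frechet_derivative
       (\<lambda>z. frechet_derivative (local_lagrangian A L c) (at z) (0, axis j 1))
       (at (coords c p, v c)) (0, axis i 1))"

definition positive_definite :: "real^'n^'n \<Rightarrow> bool" where
  "positive_definite \<mu> \<longleftrightarrow> (\<forall>w. w \<noteq> 0 \<longrightarrow> w \<bullet> (\<mu> *v w) > 0)"

definition momentum ::
  "('m, real^'n) chart set \<Rightarrow> ('m \<times> ('m, 'n) components \<Rightarrow> real)
     \<Rightarrow> 'm \<times> ('m, 'n) components \<Rightarrow> ('m, 'n) components" where
  "momentum A L = (\<lambda>(p, v) c. if c \<in> charts_at A p then dL_dv A L c (p, v) else 0)"

definition legendre ::
  "('m, real^'n) chart set \<Rightarrow> ('m \<times> ('m, 'n) components \<Rightarrow> real)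
     \<Rightarrow> 'm \<times> ('m, 'n) components \<Rightarrow> 'm \<times> ('m, 'n) components" where
  "legendre A L = (\<lambda>(p, v). (p, momentum A L (p, v)))"

text \<open>
  The Legendre map and its inverse cover the identity of the base, so smoothness of the inverse
  can be checked between the two bundle charts induced by the same chart of the base.
\<close>

definition legendre_diffeo ::
  "('m, real^'n) chart set \<Rightarrow> ('m \<times> ('m, 'n) components \<Rightarrow> real) \<Rightarrow> bool" where
  "legendre_diffeo A L \<longleftrightarrow>
     bij_betw (legendre A L) (tangent_bundle A) (cotangent_bundle A) \<and>
     (\<forall>c\<in>A. smooth_on (image_chart (bundle_chart (cotangent_bundle A) c))
        (coords (bundle_chart (tangent_bundle A) c)
          \<circ> inv_into (tangent_bundle A) (legendre A L)
          \<circ> inv_chart (bundle_chart (cotangent_bundle A) c)))"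

definition Omega ::
  "('m, real^'n) chart set \<Rightarrow> ('m \<times> ('m, 'n) components \<Rightarrow> real)
     \<Rightarrow> 'm \<times> ('m, 'n) components \<Rightarrow> real" where
  "Omega A L = (\<lambda>(p, v). pairing A p (momentum A L (p, v)) v)"


section \<open>Trajectories, variation vectors and weak normality\<close>

text \<open>
  Solutions of the modified Lagrange equations on an open interval \<open>I\<close>; the equations are
  required at every time in every chart around the current point.
\<close>

definition trajectory ::
  "('m::topological_space, real^'n) chart set \<Rightarrow> ('m \<times> ('m, 'n) components \<Rightarrow> real)
     \<Rightarrow> real set \<Rightarrow> (real \<Rightarrow> 'm) \<Rightarrow> (real \<Rightarrow> ('m, 'n) components) \<Rightarrow> bool" where
  "trajectory A L I x v \<longleftrightarrow>
     open I \<and> is_interval I \<and> continuous_on I x \<and>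
     (\<forall>t\<in>I. v t \<in> tangent_space A (x t) \<and> v t \<noteq> (\<lambda>_. 0)) \<and>
     (\<forall>t\<in>I. \<forall>c\<in>charts_at A (x t).
        (\<lambda>s. v s c) differentiable (at t) \<and>
        ((\<lambda>s. coords c (x s)) has_vector_derivative
           (1 / Omega A L (x t, v t)) *\<^sub>R v t c) (at t) \<and>
        ((\<lambda>s. dL_dv A L c (x s, v s)) has_vector_derivative
           (1 / Omega A L (x t, v t)) *\<^sub>R dL_dx A L c (x t, v t)) (at t))"

text \<open>
  A smooth one-parameter family of trajectories. The members may live on different intervals:
  \<open>W\<close> is the open set of all \<open>(t, y)\<close> such that the member with parameter \<open>y\<close> is defined at time
  \<open>t\<close>, and a parameter value outside the projection of \<open>W\<close> has an empty interval.
\<close>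

definition trajectory_family ::
  "('m::topological_space, real^'n) chart set \<Rightarrow> ('m \<times> ('m, 'n) components \<Rightarrow> real)
     \<Rightarrow> (real \<times> real) set \<Rightarrow> (real \<times> real \<Rightarrow> 'm) \<Rightarrow> (real \<times> real \<Rightarrow> ('m, 'n) components)
     \<Rightarrow> bool" where
  "trajectory_family A L W X V \<longleftrightarrow>
     open W \<and> continuous_on W X \<and>
     (\<forall>c\<in>A. smooth_on {z \<in> W. X z \<in> dom_chart c} (\<lambda>z. (coords c (X z), V z c))) \<and>
     (\<forall>y. trajectory A L {t. (t, y) \<in> W} (\<lambda>t. X (t, y)) (\<lambda>t. V (t, y)))"

definition variation_vector ::
  "('m::topological_space, real^'n) chart set \<Rightarrow> ('m \<times> ('m, 'n) components \<Rightarrow> real)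
     \<Rightarrow> real set \<Rightarrow> (real \<Rightarrow> 'm) \<Rightarrow> (real \<Rightarrow> ('m, 'n) components)
     \<Rightarrow> (real \<Rightarrow> ('m, 'n) components) \<Rightarrow> bool" where
  "variation_vector A L I x v \<tau> \<longleftrightarrow>
     (\<exists>W X V y0. trajectory_family A L W X V \<and>
        {t. (t, y0) \<in> W} = I \<and>
        (\<forall>t\<in>I. X (t, y0) = x t \<and> V (t, y0) = v t) \<and>
        (\<forall>t\<in>I. \<tau> t = (\<lambda>c. if c \<in> charts_at A (x t)
                             then vector_derivative (\<lambda>y. coords c (X (t, y))) (at y0) else 0)))"

definition deviation_function ::
  "('m, real^'n) chart set \<Rightarrow> ('m \<times> ('m, 'n) components \<Rightarrow> real)
     \<Rightarrow> (real \<Rightarrow> 'm) \<Rightarrow> (real \<Rightarrow> ('m, 'n) components) \<Rightarrow> (real \<Rightarrow> ('m, 'n) components)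
     \<Rightarrow> real \<Rightarrow> real" where
  "deviation_function A L x v \<tau> t = pairing A (x t) (momentum A L (x t, v t)) (\<tau> t)"

definition weak_normality ::
  "('m::topological_space, real^'n) chart set \<Rightarrow> ('m \<times> ('m, 'n) components \<Rightarrow> real) \<Rightarrow> bool" where
  "weak_normality A L \<longleftrightarrow>
     (\<forall>I x v. trajectory A L I x v \<longrightarrow>
        (\<exists>\<A> \<B> :: real \<Rightarrow> real. \<forall>\<tau>. variation_vector A L I x v \<tau> \<longrightarrow>
           (let \<phi> = deviation_function A L x v \<tau> in
            \<forall>t\<in>I. \<phi> differentiable (at t) \<and>
                  (deriv \<phi> has_real_derivative \<A> t * deriv \<phi> t + \<B> t * \<phi> t) (at t))))"

end

theory Submission
  imports Defs
begin

text \<open>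
  The energy \<open>H = \<Omega> - L\<close> is constant along every trajectory. Differentiating \<open>\<phi>\<close> along the
  given trajectory and commuting \<open>\<partial>/\<partial>t\<close> with \<open>\<partial>/\<partial>y\<close> gives \<open>\<phi>' = - (\<partial>H/\<partial>y) / \<Omega>\<close>, and
  \<open>\<partial>H/\<partial>y\<close> does not depend on \<open>t\<close>. Hence \<open>\<phi>'' = - (\<Omega>' / \<Omega>) \<phi>'\<close>, that is, the condition holds
  with \<open>\<A> = - \<Omega>' / \<Omega>\<close> and \<open>\<B> = 0\<close>.
\<close>

section \<open>Smooth functions: restriction, differentiability, continuity\<close>

lemma Ck_on_subset: "Ck_on k S f \<Longrightarrow> T \<subseteq> S \<Longrightarrow> Ck_on k T f"
  by (induction k arbitrary: f) (auto intro: continuous_on_subset)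

lemma smooth_on_subset: "smooth_on S f \<Longrightarrow> T \<subseteq> S \<Longrightarrow> smooth_on T f"
  unfolding smooth_on_def using Ck_on_subset by blast

lemma smooth_on_differentiable: "smooth_on S f \<Longrightarrow> z \<in> S \<Longrightarrow> f differentiable (at z)"
  unfolding smooth_on_def by (metis Ck_on.simps(2))

lemma smooth_on_frechet_derivative:
  "smooth_on S f \<Longrightarrow> smooth_on S (\<lambda>z. frechet_derivative f (at z) h)"
  unfolding smooth_on_def by (metis Ck_on.simps(2))

lemma smooth_on_continuous_on: "smooth_on S f \<Longrightarrow> continuous_on S f"
  unfolding smooth_on_def by (metis Ck_on.simps(1))

section \<open>Partial derivatives in two real variables and their symmetry\<close>

lemma partial_derivatives:
  fixes F :: "real \<times> real \<Rightarrow> 'b::real_normed_vector"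
  assumes "F differentiable (at (t, y))"
  shows "((\<lambda>s. F (s, y)) has_vector_derivative frechet_derivative F (at (t, y)) (1, 0)) (at t)"
    and "((\<lambda>r. F (t, r)) has_vector_derivative frechet_derivative F (at (t, y)) (0, 1)) (at y)"
proof -
  have F: "(F has_derivative frechet_derivative F (at (t, y))) (at (t, y))"
    using assms frechet_derivative_works by blast
  have 1: "((\<lambda>s. (s, y)) has_vector_derivative (1, 0)) (at t)"
    and 2: "((\<lambda>r. (t, r)) has_vector_derivative (0, 1)) (at y)"
    unfolding has_vector_derivative_def by (auto intro!: derivative_eq_intros)
  show "((\<lambda>s. F (s, y)) has_vector_derivative frechet_derivative F (at (t, y)) (1, 0)) (at t)"
    using vector_derivative_diff_chain_within[OF 1 has_derivative_at_withinI[OF F]]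
    by (simp add: o_def)
  show "((\<lambda>r. F (t, r)) has_vector_derivative frechet_derivative F (at (t, y)) (0, 1)) (at y)"
    using vector_derivative_diff_chain_within[OF 2 has_derivative_at_withinI[OF F]]
    by (simp add: o_def)
qed

text \<open>Symmetry of mixed partial derivatives, obtained by integration: \<open>fy\<close> is its
  value at a base point plus an integral of the continuous function \<open>fty\<close>, and such an
  integral is differentiable in its upper limit. For families of trajectories this turns the time
  derivative of a variation vector into the y-derivative of a velocity.\<close>

lemma vector_derivative_of_partial_derivative:
  fixes f :: "real \<times> real \<Rightarrow> 'b::euclidean_space"
  assumes f: "smooth_on ({a<..<b} \<times> {c<..<d}) f" and t: "t \<in> {a<..<b}" and y: "y \<in> {c<..<d}"
  shows "((\<lambda>s. vector_derivative (\<lambda>r. f (s, r)) (at y)) has_vector_derivative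
    vector_derivative (\<lambda>r. vector_derivative (\<lambda>s. f (s, r)) (at t)) (at y)) (at t)"
proof -
  define ft where "ft z = frechet_derivative f (at z) (1, 0)" for z
  define fy where "fy z = frechet_derivative f (at z) (0, 1)" for z
  define fty where "fty z = frechet_derivative ft (at z) (0, 1)" for z
  let ?R = "{a<..<b} \<times> {c<..<d}"
  have ft_smooth: "smooth_on ?R ft"
    unfolding ft_def by (rule smooth_on_frechet_derivative[OF f])
  have ft: "((\<lambda>s. f (s, r)) has_vector_derivative ft (s, r)) (at s)" 
    and fy: "((\<lambda>r. f (s, r)) has_vector_derivative fy (s, r)) (at r)" 
    and fty: "((\<lambda>r. ft (s, r)) has_vector_derivative fty (s, r)) (at r)" 
    if "(s, r) \<in> ?R" for s r
    unfolding ft_def[of "(s, r)"] fy_def fty_def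
    using partial_derivatives smooth_on_differentiable[OF f that]
      smooth_on_differentiable[OF ft_smooth that] by blast+
  have cont_ft: "continuous_on ?R ft"
    by (rule smooth_on_continuous_on[OF ft_smooth])
  have cont_fty: "continuous_on ?R fty"
    unfolding fty_def by (rule smooth_on_continuous_on[OF smooth_on_frechet_derivative[OF ft_smooth]])
  \<comment> \<open>A compact interval around \<open>t\<close> inside the open one: the integrals
    run over closed intervals, and \<open>t\<close> stays interior, so a derivative within it is a
    full derivative.\<close>
  obtain a' where a': "a < a'" "a' < t" using t dense by auto
  obtain b' where b': "t < b'" "b' < b" using t dense by auto
  have fy_eq: "fy (u, y) = fy (a', y) + integral {a'..u} (\<lambda>s. fty (s, y))" if u: "u \<in> {a'..b'}" for u
  proof -
    have sub: "{a'..u} \<subseteq> {a<..<b}" using u a' b' by auto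
    \<comment> \<open>The integral of \<open>ft\<close> from \<open>a'\<close> to \<open>u\<close>
      is differentiated in \<open>r\<close> twice over: under the integral sign, and after
      evaluating it as \<open>f (u, r) - f (a', r)\<close>. Comparing the results gives the
      claim.\<close>
    have "((\<lambda>r. integral (cbox a' u) (\<lambda>s. ft (s, r))) has_vector_derivative
             integral (cbox a' u) (\<lambda>s. fty (s, y))) (at y within {c<..<d})"
    proof (rule leibniz_rule_vector_derivative)
      fix r s assume rs: "r \<in> {c<..<d}" "s \<in> cbox a' u"
      then show "((\<lambda>r. ft (s, r)) has_vector_derivative fty (s, r)) (at r within {c<..<d})"
        using sub by (intro has_vector_derivative_at_within[OF fty]) auto
    next
      fix r assume r: "r \<in> {c<..<d}"
      show "(\<lambda>s. ft (s, r)) integrable_on cbox a' u"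
        using r sub by (intro integrable_continuous continuous_on_compose2[OF cont_ft])
          (auto intro!: continuous_intros)
    next
      show "continuous_on ({c<..<d} \<times> cbox a' u) (\<lambda>(r, s). fty (s, r))"
        unfolding case_prod_beta using sub
        by (intro continuous_on_compose2[OF cont_fty]) (auto intro!: continuous_intros)
    qed (use y in auto)
    then have "((\<lambda>r. integral {a'..u} (\<lambda>s. ft (s, r))) has_vector_derivative
             integral {a'..u} (\<lambda>s. fty (s, y))) (at y)"
      unfolding at_within_open[OF y open_greaterThanLessThan] cbox_interval .
    moreover have "integral {a'..u} (\<lambda>s. ft (s, r)) = f (u, r) - f (a', r)" if "r \<in> {c<..<d}" for r
    proof (intro integral_unique fundamental_theorem_of_calculus)
      fix s assume "s \<in> {a'..u}"
      then show "((\<lambda>s. f (s, r)) has_vector_derivative ft (s, r)) (at s within {a'..u})"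
        using sub that by (intro has_vector_derivative_at_within[OF ft]) auto
    qed (use u in auto)
    ultimately have "((\<lambda>r. f (u, r) - f (a', r)) has_vector_derivative
             integral {a'..u} (\<lambda>s. fty (s, y))) (at y)"
      using y by (elim has_vector_derivative_transform_within_open[of _ _ _ "{c<..<d}"]) auto
    moreover have "((\<lambda>r. f (u, r) - f (a', r)) has_vector_derivative fy (u, y) - fy (a', y)) (at y)"
      using u y a' b' by (intro has_vector_derivative_diff fy) auto
    ultimately have "fy (u, y) - fy (a', y) = integral {a'..u} (\<lambda>s. fty (s, y))"
      by (metis vector_derivative_at)
    then show ?thesis by (simp add: algebra_simps)
  qed
  have "((\<lambda>u. fy (a', y) + integral {a'..u} (\<lambda>s. fty (s, y))) has_vector_derivative 0 + fty (t, y))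
     (at t within {a'..b'})"
    using a' b' y
    by (intro has_vector_derivative_add has_vector_derivative_const integral_has_vector_derivative
        continuous_on_compose2[OF cont_fty]) (auto intro!: continuous_intros)
  then have "((\<lambda>u. fy (a', y) + integral {a'..u} (\<lambda>s. fty (s, y))) has_vector_derivative fty (t, y)) (at t)"
    using a' b' by (simp add: at_within_Icc_at)
  moreover have "fy (a', y) + integral {a'..u} (\<lambda>s. fty (s, y)) = vector_derivative (\<lambda>r. f (u, r)) (at y)"
    if "u \<in> {a'<..<b'}" for u
    using fy_eq[of u] vector_derivative_at[OF fy, of u y] that a' b' y by auto
  ultimately have 1: "((\<lambda>u. vector_derivative (\<lambda>r. f (u, r)) (at y)) has_vector_derivative fty (t, y)) (at t)"
    using a' b' by (elim has_vector_derivative_transform_within_open[of _ _ _ "{a'<..<b'}"]) auto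
  \<comment> \<open>The other order is immediate: for \<open>r\<close> near \<open>y\<close> the
    inner derivative is \<open>ft (t, r)\<close>.\<close>
  have "((\<lambda>r. vector_derivative (\<lambda>s. f (s, r)) (at t)) has_vector_derivative fty (t, y)) (at y)"
    using t y by (intro has_vector_derivative_transform_within_open[OF fty, of _ _ "{c<..<d}"])
      (auto simp: vector_derivative_at[OF ft])
  then show ?thesis
    using 1 by (simp add: vector_derivative_at)
qed

section \<open>The deviation function in one chart\<close>

text \<open>By linearity the derivative is determined by its values on the unit vectors of both
  factors. The two gradients have the form of \<open>dL_dx\<close> and \<open>dL_dv\<close>, so the
  chain rule along a curve splits into a position part and a velocity part.\<close>

lemma has_derivative_partials:
  fixes l :: "(real^'n) \<times> (real^'n) \<Rightarrow> real"
  assumes "l differentiable (at q)"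
  shows "(l has_derivative (\<lambda>h. (\<chi> i. frechet_derivative l (at q) (axis i 1, 0)) \<bullet> fst h
    + (\<chi> i. frechet_derivative l (at q) (0, axis i 1)) \<bullet> snd h)) (at q)"
proof -
  let ?D = "frechet_derivative l (at q)"
  have D: "(l has_derivative ?D) (at q)" 
    using assms frechet_derivative_works by blast
  interpret linear ?D using D by (rule has_derivative_linear)
  have "?D = (\<lambda>h. (\<chi> i. ?D (axis i 1, 0)) \<bullet> fst h + (\<chi> i. ?D (0, axis i 1)) \<bullet> snd h)"
  proof
    fix h :: "(real^'n) \<times> (real^'n)"
    have e: "w = (\<Sum>i\<in>UNIV. w $ i *\<^sub>R axis i 1)" for w :: "real^'n"
      using basis_expansion[of w] by (simp add: scalar_mult_eq_scaleR)
    have "h = (\<Sum>i\<in>UNIV. fst h $ i *\<^sub>R (axis i 1, 0)) + (\<Sum>i\<in>UNIV. snd h $ i *\<^sub>R (0, axis i 1))"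
      by (rule prod_eqI) (simp_all add: fst_sum snd_sum flip: e)
    then have "?D h = ?D ((\<Sum>i\<in>UNIV. fst h $ i *\<^sub>R (axis i 1, 0)) + (\<Sum>i\<in>UNIV. snd h $ i *\<^sub>R (0, axis i 1)))"
      by (rule arg_cong)
    also have "\<dots> = (\<Sum>i\<in>UNIV. fst h $ i *\<^sub>R ?D (axis i 1, 0)) + (\<Sum>i\<in>UNIV. snd h $ i *\<^sub>R ?D (0, axis i 1))"
      by (simp only: add sum scale)
    also have "\<dots> = (\<chi> i. ?D (axis i 1, 0)) \<bullet> fst h + (\<chi> i. ?D (0, axis i 1)) \<bullet> snd h"
      by (simp add: inner_vec_def mult.commute)
    finally show "?D h = (\<chi> i. ?D (axis i 1, 0)) \<bullet> fst h + (\<chi> i. ?D (0, axis i 1)) \<bullet> snd h" .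
  qed
  with D show ?thesis by (rule subst[rotated])
qed

text \<open>Coordinate form of the argument: \<open>l\<close> is the Lagrangian in a bundle chart,
  \<open>z\<close> a family of trajectories there, \<open>pv\<close> the momentum and
  \<open>om\<close> the function \<open>Omega\<close>. The constant \<open>C\<close> is the
  y-derivative of the energy at \<open>y0\<close>; it depends on the family, whereas
  \<open>om (z (t, y0))\<close> depends on the given trajectory alone.\<close>

lemma has_real_derivative_deviation:
  fixes l :: "(real^'n) \<times> (real^'n) \<Rightarrow> real" and z :: "real \<times> real \<Rightarrow> (real^'n) \<times> (real^'n)"
  assumes l: "smooth_on S l"
    and z: "smooth_on ({a<..<b} \<times> {c<..<d}) z"
    and zS: "\<And>t y. t \<in> {a<..<b} \<Longrightarrow> y \<in> {c<..<d} \<Longrightarrow> z (t, y) \<in> S"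
    and px: "\<And>q. px q = (\<chi> i. frechet_derivative l (at q) (axis i 1, 0))"
    and pv: "\<And>q. pv q = (\<chi> i. frechet_derivative l (at q) (0, axis i 1))"
    and om: "\<And>q. om q = pv q \<bullet> snd q"
    and pos: "\<And>t y. t \<in> {a<..<b} \<Longrightarrow> y \<in> {c<..<d} \<Longrightarrow> om (z (t, y)) > 0"
    and ode_x: "\<And>t y. t \<in> {a<..<b} \<Longrightarrow> y \<in> {c<..<d} \<Longrightarrow>
      ((\<lambda>s. fst (z (s, y))) has_vector_derivative (1 / om (z (t, y))) *\<^sub>R snd (z (t, y))) (at t)"
    and ode_p: "\<And>t y. t \<in> {a<..<b} \<Longrightarrow> y \<in> {c<..<d} \<Longrightarrow>
      ((\<lambda>s. pv (z (s, y))) has_vector_derivative (1 / om (z (t, y))) *\<^sub>R px (z (t, y))) (at t)"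
    and y0: "y0 \<in> {c<..<d}"
  obtains C where "\<And>t. t \<in> {a<..<b} \<Longrightarrow>
    ((\<lambda>s. pv (z (s, y0)) \<bullet> vector_derivative (\<lambda>y. fst (z (s, y))) (at y0))
      has_real_derivative - C / om (z (t, y0))) (at t)"
proof -
  define H where "H q = om q - l q" for q
  define zt where "zt p = frechet_derivative z (at p) (1, 0)" for p
  define zy where "zy p = frechet_derivative z (at p) (0, 1)" for p
  let ?R = "{a<..<b} \<times> {c<..<d}"
  have zt: "((\<lambda>s. z (s, y)) has_vector_derivative zt (t, y)) (at t)" 
    and zy: "((\<lambda>r. z (t, r)) has_vector_derivative zy (t, y)) (at y)" 
    if "t \<in> {a<..<b}" "y \<in> {c<..<d}" for t y
    unfolding zt_def zy_def
    using partial_derivatives[of z t y] smooth_on_differentiable[OF z, of "(t, y)"] that by auto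
  have fst_vd: "((\<lambda>s. fst (g s)) has_vector_derivative fst g') F"
    and snd_vd: "((\<lambda>s. snd (g s)) has_vector_derivative snd g') F"
    if "(g has_vector_derivative g') F" for g :: "real \<Rightarrow> (real^'n) \<times> (real^'n)" and g' F
    using that unfolding has_vector_derivative_def
    by (auto intro!: derivative_eq_intros)
  have inner_vd: "((\<lambda>s. g s \<bullet> h s) has_real_derivative g' \<bullet> h t + g t \<bullet> h') (at t)"
    if "(g has_vector_derivative g') (at t)" "(h has_vector_derivative h') (at t)" 
    for g h :: "real \<Rightarrow> real^'n" and g' h' t
    using has_derivative_inner[OF that[unfolded has_vector_derivative_def]]
    by (elim has_derivative_imp_has_field_derivative) (simp add: inner_commute algebra_simps)
  have l_chain: "((\<lambda>s. l (g s)) has_real_derivative px (g t) \<bullet> fst g' + pv (g t) \<bullet> snd g') (at t)"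
    if "(g has_vector_derivative g') (at t)" "g t \<in> S" for g g' t
  proof -
    have "(l has_derivative (\<lambda>h. px (g t) \<bullet> fst h + pv (g t) \<bullet> snd h)) (at (g t))"
      unfolding px pv using smooth_on_differentiable[OF l that(2)] by (rule has_derivative_partials)
    from vector_derivative_diff_chain_within[OF that(1) has_derivative_at_withinI[OF this]]
    show ?thesis
      by (simp add: o_def has_real_derivative_iff_has_vector_derivative)
  qed
  \<comment> \<open>The product of momentum with the time derivative of the vector occurs in the
    derivatives of both \<open>om\<close> and \<open>l\<close> and cancels. By the equations of
    motion the remaining terms are both \<open>px \<bullet> snd z / om\<close>, with opposite
    signs.\<close>
  have H_t: "((\<lambda>s. H (z (s, y))) has_vector_derivative 0) (at t)" 
    if "t \<in> {a<..<b}" "y \<in> {c<..<d}" for t y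
  proof -
    have "fst (zt (t, y)) = (1 / om (z (t, y))) *\<^sub>R snd (z (t, y))"
      using fst_vd[OF zt[OF that]] ode_x[OF that] by (metis vector_derivative_at)
    then show ?thesis
      using DERIV_diff[OF inner_vd[OF ode_p[OF that] snd_vd[OF zt[OF that]]]
          l_chain[OF zt[OF that] zS[OF that]]]
      unfolding H_def om has_real_derivative_iff_has_vector_derivative by simp
  qed
  have H_const: "H (z (t, y)) = H (z (t', y))" 
    if "t \<in> {a<..<b}" "t' \<in> {a<..<b}" "y \<in> {c<..<d}" for t t' y
    using H_t that has_derivative_zero_unique[of "{a<..<b}" "\<lambda>t. H (z (t, y))" t t']
    by (auto simp: has_vector_derivative_def has_derivative_at_withinI)
  have pv_diff: "pv differentiable (at q)" if "q \<in> S" for q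
  proof -
    have "(\<lambda>q. pv q \<bullet> b) differentiable (at q)" if b: "b \<in> Basis" for b
    proof -
      obtain i where "b = axis i 1" using b by (auto simp: Basis_vec_def)
      then have "(\<lambda>q. pv q \<bullet> b) = (\<lambda>q. frechet_derivative l (at q) (0, axis i 1))"
        by (simp add: pv inner_axis)
      then show ?thesis
        using smooth_on_differentiable[OF smooth_on_frechet_derivative[OF l] \<open>q \<in> S\<close>] by simp
    qed
    then show ?thesis by (subst differentiable_componentwise_within) blast
  qed
  \<comment> \<open>\<open>py\<close>, \<open>omy\<close> and \<open>hy\<close> are the
    y-derivatives at \<open>y0\<close> of the momentum, of \<open>om\<close> and of the energy. In
    \<open>hy\<close> the momentum term is not cancelled against \<open>omy\<close>, since the
    derivative of the deviation function produces it in this form.\<close>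
  define py where "py t = frechet_derivative pv (at (z (t, y0))) (zy (t, y0))" for t
  define omy where "omy t = py t \<bullet> snd (z (t, y0)) + pv (z (t, y0)) \<bullet> snd (zy (t, y0))" for t
  define hy where "hy t = omy t - (px (z (t, y0)) \<bullet> fst (zy (t, y0)) + pv (z (t, y0)) \<bullet> snd (zy (t, y0)))" for t
  have om_y: "((\<lambda>r. om (z (t, r))) has_real_derivative omy t) (at y0)" if t: "t \<in> {a<..<b}" for t
  proof -
    have "(pv has_derivative frechet_derivative pv (at (z (t, y0)))) (at (z (t, y0)))"
      using pv_diff[OF zS[OF t y0]] frechet_derivative_works by blast
    from vector_derivative_diff_chain_within[OF zy[OF t y0] has_derivative_at_withinI[OF this]]
    have "((\<lambda>r. pv (z (t, r))) has_vector_derivative py t) (at y0)"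
      by (simp add: o_def py_def)
    from inner_vd[OF this snd_vd[OF zy[OF t y0]]] show ?thesis
      unfolding om omy_def .
  qed
  have H_y: "((\<lambda>r. H (z (t, r))) has_real_derivative hy t) (at y0)" if t: "t \<in> {a<..<b}" for t
    unfolding H_def hy_def
    by (rule DERIV_diff[OF om_y[OF t] l_chain[OF zy[OF t y0] zS[OF t y0]]])
  \<comment> \<open>Energy is conserved by every member of the family, so at times \<open>t\<close>
    and \<open>t'\<close> it is the same function of the parameter near \<open>y0\<close>.\<close>
  have hy_const: "hy t = hy t'" if "t \<in> {a<..<b}" "t' \<in> {a<..<b}" for t t'
  proof -
    have "((\<lambda>r. H (z (t', r))) has_real_derivative hy t) (at y0)"
      using H_y[OF that(1)] y0 H_const[OF that]
      by (elim has_field_derivative_transform_within_open[of _ _ _ "{c<..<d}"]) auto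
    with H_y[OF that(2)] show ?thesis by (metis DERIV_unique)
  qed
  have main: "((\<lambda>s. pv (z (s, y0)) \<bullet> vector_derivative (\<lambda>y. fst (z (s, y))) (at y0))
      has_real_derivative - hy t / om (z (t, y0))) (at t)" if t: "t \<in> {a<..<b}" for t
  proof -
    let ?q = "z (t, y0)"
    \<comment> \<open>The y-derivative of the velocity, by the quotient rule.\<close>
    define g' where "g' = (1 / om ?q) *\<^sub>R snd (zy (t, y0)) - (omy t / (om ?q)\<^sup>2) *\<^sub>R snd ?q"
    have "((\<lambda>r. 1 / om (z (t, r))) has_real_derivative - (omy t / (om ?q)\<^sup>2)) (at y0)"
      using om_y[OF t] pos[OF t y0]
      by (auto intro!: derivative_eq_intros simp: power2_eq_square)
    then have g: "((\<lambda>r. (1 / om (z (t, r))) *\<^sub>R snd (z (t, r))) has_vector_derivative g') (at y0)"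
      using has_vector_derivative_scaleR[OF _ snd_vd[OF zy[OF t y0]]]
      unfolding g'_def by (fastforce simp: algebra_simps)
    have "smooth_on ?R zt"
      unfolding zt_def by (rule smooth_on_frechet_derivative[OF z])
    then have "zt differentiable (at (t, y0))"
      using t y0 by (intro smooth_on_differentiable) auto
    then have zty: "((\<lambda>r. zt (t, r)) has_vector_derivative frechet_derivative zt (at (t, y0)) (0, 1)) (at y0)"
      by (rule partial_derivatives)
    then have "((\<lambda>r. vector_derivative (\<lambda>s. z (s, r)) (at t)) has_vector_derivative
        frechet_derivative zt (at (t, y0)) (0, 1)) (at y0)"
      using y0 t by (elim has_vector_derivative_transform_within_open[of _ _ _ "{c<..<d}"])
        (auto simp: vector_derivative_at[OF zt])
    then have tau: "((\<lambda>s. vector_derivative (\<lambda>r. z (s, r)) (at y0)) has_vector_derivative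
        frechet_derivative zt (at (t, y0)) (0, 1)) (at t)"
      using vector_derivative_of_partial_derivative[OF z t y0] by (simp add: vector_derivative_at)
    \<comment> \<open>The first equation of motion holds for all parameters near \<open>y0\<close>
      and may be differentiated in the parameter. Uniqueness of derivatives then identifies the
      position part of the mixed partial derivative with \<open>g'\<close>.\<close>
    have "((\<lambda>r. (1 / om (z (t, r))) *\<^sub>R snd (z (t, r))) has_vector_derivative
        fst (frechet_derivative zt (at (t, y0)) (0, 1))) (at y0)"
    proof (rule has_vector_derivative_transform_within_open[OF fst_vd[OF zty], of "{c<..<d}"])
      fix r assume r: "r \<in> {c<..<d}"
      show "fst (zt (t, r)) = (1 / om (z (t, r))) *\<^sub>R snd (z (t, r))"
        using fst_vd[OF zt[OF t r]] ode_x[OF t r] by (metis vector_derivative_at)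
    qed (use y0 in auto)
    then have g'_eq: "fst (frechet_derivative zt (at (t, y0)) (0, 1)) = g'"
      using g by (rule vector_derivative_unique_at)
    have tau_eq: "vector_derivative (\<lambda>r. fst (z (s, r))) (at y0) = fst (zy (s, y0))" 
      "vector_derivative (\<lambda>r. z (s, r)) (at y0) = zy (s, y0)" if "s \<in> {a<..<b}" for s
      using fst_vd[OF zy[OF that y0]] zy[OF that y0] by (simp_all add: vector_derivative_at)
    have "((\<lambda>s. vector_derivative (\<lambda>y. fst (z (s, y))) (at y0)) has_vector_derivative g') (at t)"
      using fst_vd[OF tau] t unfolding g'_eq
      by (elim has_vector_derivative_transform_within_open[of _ _ _ "{a<..<b}"]) (auto simp: tau_eq)
    from inner_vd[OF ode_p[OF t y0] this]
    have "((\<lambda>s. pv (z (s, y0)) \<bullet> vector_derivative (\<lambda>y. fst (z (s, y))) (at y0)) has_real_derivative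
      ((1 / om ?q) *\<^sub>R px ?q) \<bullet> fst (zy (t, y0)) + pv ?q \<bullet> g') (at t)"
      by (simp only: tau_eq[OF t])
    moreover have "((1 / om ?q) *\<^sub>R px ?q) \<bullet> fst (zy (t, y0)) + pv ?q \<bullet> g' = - hy t / om ?q"
    proof -
      \<comment> \<open>Since \<open>pv ?q \<bullet> snd ?q\<close> is \<open>om ?q\<close>, the
        quotient rule term contributes just \<open>- omy t / om ?q\<close>, the part of
        \<open>- hy t / om ?q\<close> that comes from \<open>om\<close>.\<close>
      have "pv ?q \<bullet> g' = pv ?q \<bullet> snd (zy (t, y0)) / om ?q - omy t / (om ?q)\<^sup>2 * om ?q"
        unfolding g'_def by (simp add: inner_diff_right om)
      then show ?thesis
        using pos[OF t y0] unfolding hy_def by (simp add: field_simps power2_eq_square)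
    qed
    ultimately show ?thesis by simp
  qed
  show thesis
  proof (rule that)
    fix t assume t: "t \<in> {a<..<b}"
    \<comment> \<open>The midpoint serves as a reference time that does not depend on
      \<open>t\<close>.\<close>
    then have "hy t = hy ((a + b) / 2)" by (intro hy_const) auto
    with main[OF t] show "((\<lambda>s. pv (z (s, y0)) \<bullet> vector_derivative (\<lambda>y. fst (z (s, y))) (at y0))
      has_real_derivative - hy ((a + b) / 2) / om (z (t, y0))) (at t)" by simp
  qed
qed

section \<open>Momentum pairing and variation vectors in charts\<close>

text \<open>The covector transformation law is read off from the Legendre map having its values in
  the cotangent bundle, which is part of its bijectivity.\<close>

lemma momentum_in_cotangent_space:
  assumes "legendre_diffeo A L" "v \<in> tangent_space A p"
  shows "momentum A L (p, v) \<in> cotangent_space A p"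
proof -
  have "legendre A L (p, v) \<in> cotangent_bundle A"
    using assms unfolding legendre_diffeo_def tangent_bundle_def by (auto dest!: bij_betwE)
  then show ?thesis
    by (simp add: legendre_def cotangent_bundle_def)
qed

lemma pairing_momentum:
  assumes "legendre_diffeo A L" "v \<in> tangent_space A p" "w \<in> tangent_space A p" "c \<in> charts_at A p"
  shows "pairing A p (momentum A L (p, v)) w = dL_dv A L c (p, v) \<bullet> w c"
  using pairing_eq[OF momentum_in_cotangent_space[OF assms(1,2)] assms(3,4)] assms(4)
  by (simp add: momentum_def inner_vec_def)

lemma Omega_eq_inner:
  assumes "legendre_diffeo A L" "v \<in> tangent_space A p" "c \<in> charts_at A p"
  shows "Omega A L (p, v) = dL_dv A L c (p, v) \<bullet> v c"
  using pairing_momentum[OF assms(1,2,2,3)] by (simp add: Omega_def)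

lemma open_chart_preimage:
  assumes "smooth_atlas A" "trajectory_family A L W X V" "c \<in> A"
  shows "open {z \<in> W. X z \<in> dom_chart c}"
proof -
  have "open (W \<inter> X -` dom_chart c)"
    using assms unfolding smooth_atlas_def trajectory_family_def
    by (intro continuous_open_preimage) auto
  then show ?thesis by (simp add: Int_def vimage_def)
qed

lemma inv_chart_coords:
  assumes "smooth_atlas A" "c \<in> A" "p \<in> dom_chart c"
  shows "inv_chart c (coords c p) = p"
proof -
  have "homeomorphism (dom_chart c) (image_chart c) (coords c) (inv_chart c)"
    using assms(1,2) unfolding smooth_atlas_def by blast
  then show ?thesis
    using assms(3) by (rule homeomorphism_apply1)
qed

text \<open>The chain rule for the transition map is exactly the vector transformation law. With it
  the pairing of momentum and variation vector can be computed in any chart around the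
  point.\<close>

lemma variation_in_tangent_space:
  assumes A: "smooth_atlas A" and fam: "trajectory_family A L W X V" and s: "(s, y0) \<in> W"
  shows "(\<lambda>c. if c \<in> charts_at A (X (s, y0))
            then vector_derivative (\<lambda>y. coords c (X (s, y))) (at y0) else 0)
         \<in> tangent_space A (X (s, y0))"
proof -
  let ?p = "X (s, y0)"
  have transformation: "vector_derivative (\<lambda>y. coords c' (X (s, y))) (at y0) =
        frechet_derivative (transition c c') (at (coords c ?p))
          (vector_derivative (\<lambda>y. coords c (X (s, y))) (at y0))"
    if c: "c \<in> charts_at A ?p" and c': "c' \<in> charts_at A ?p" for c c'
  proof -
    have cA: "c \<in> A" "?p \<in> dom_chart c" "c' \<in> A" "?p \<in> dom_chart c'" 
      using c c' by (auto simp: charts_at_def)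
    \<comment> \<open>The parameters for which the point lies in both chart domains. On this open
      set \<open>coords c'\<close> is \<open>transition c c'\<close> applied to
      \<open>coords c\<close>, so both sides have the same derivative at \<open>y0\<close>.\<close>
    let ?N = "Pair s -` ({z \<in> W. X z \<in> dom_chart c} \<inter> {z \<in> W. X z \<in> dom_chart c'})"
    have N: "open ?N"
      using open_chart_preimage[OF A fam] cA
      by (intro open_vimage open_Int) (auto intro!: continuous_intros)
    have "smooth_on {z \<in> W. X z \<in> dom_chart c} (\<lambda>z. (coords c (X z), V z c))"
      using fam cA(1) unfolding trajectory_family_def by blast
    then have "(\<lambda>z. (coords c (X z), V z c)) differentiable (at (s, y0))"
      by (rule smooth_on_differentiable) (use cA(2) s in simp)
    from partial_derivatives(2)[OF this] obtain D where
      "((\<lambda>y. (coords c (X (s, y)), V (s, y) c)) has_vector_derivative D) (at y0)" by blast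
    then have D: "((\<lambda>y. coords c (X (s, y))) has_vector_derivative fst D) (at y0)"
      unfolding has_vector_derivative_def by (auto dest: has_derivative_fst)
    have "smooth_on (coords c ` (dom_chart c \<inter> dom_chart c')) (transition c c')"
      using A cA(1,3) unfolding smooth_atlas_def by blast
    then have "transition c c' differentiable (at (coords c ?p))"
      by (rule smooth_on_differentiable) (use cA(2,4) in blast)
    then have "(transition c c' has_derivative frechet_derivative (transition c c') (at (coords c ?p)))
        (at (coords c ?p))"
      using frechet_derivative_works by blast
    from vector_derivative_diff_chain_within[OF D has_derivative_at_withinI[OF this]]
    have "((\<lambda>y. transition c c' (coords c (X (s, y)))) has_vector_derivative
        frechet_derivative (transition c c') (at (coords c ?p)) (fst D)) (at y0)"
      by (simp add: o_def)
    then have "((\<lambda>y. coords c' (X (s, y))) has_vector_derivative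
        frechet_derivative (transition c c') (at (coords c ?p)) (fst D)) (at y0)"
      using s cA by (elim has_vector_derivative_transform_within_open[OF _ N])
        (auto simp: transition_def inv_chart_coords[OF A cA(1)])
    with D show ?thesis by (simp add: vector_derivative_at)
  qed
  show ?thesis
    unfolding tangent_space_def
    by (intro CollectI conjI ballI allI impI) (simp_all only: if_True if_False, rule transformation)
qed

section \<open>From the chart computation to weak normality\<close>

theorem theorem7p1:
  fixes A :: "('m::{t2_space,second_countable_topology}, real^'n) chart set"
    and L :: "'m \<times> ('m, 'n) components \<Rightarrow> real"
  assumes "smooth_atlas A"
    and "smooth_lagrangian A L"
    and "legendre_diffeo A L"
    and "\<And>p v c. v \<in> tangent_space A p \<Longrightarrow> c \<in> charts_at A p \<Longrightarrow>
           positive_definite (fibre_hessian A L c (p, v))"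
    and "\<And>p v. v \<in> tangent_space A p \<Longrightarrow> v \<noteq> (\<lambda>_. 0) \<Longrightarrow> Omega A L (p, v) > 0"
  shows "weak_normality A L"
proof -
  \<comment> \<open>The coefficient of \<open>deriv \<phi>\<close> is built from
    \<open>Omega\<close> along the given trajectory; neither \<open>\<tau>\<close> nor the family
    enters. The coefficient of \<open>\<phi>\<close> is zero, so its term is absent.\<close>
  have normal: "\<phi> differentiable (at t) \<and>
      (deriv \<phi> has_real_derivative (- deriv (\<lambda>s. Omega A L (x s, v s)) t / Omega A L (x t, v t))
         * deriv \<phi> t) (at t)"
    if traj: "trajectory A L I x v" and var: "variation_vector A L I x v \<tau>"
      and \<phi>: "\<phi> = deviation_function A L x v \<tau>" and t: "t \<in> I" for I x v \<tau> \<phi> t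
  proof -
    let ?Om = "\<lambda>s. Omega A L (x s, v s)"
    obtain W X V y0 where fam: "trajectory_family A L W X V" and WI: "{t. (t, y0) \<in> W} = I"
      and XV: "\<And>t. t \<in> I \<Longrightarrow> X (t, y0) = x t \<and> V (t, y0) = v t"
      and \<tau>: "\<And>t. t \<in> I \<Longrightarrow> \<tau> t = (\<lambda>c. if c \<in> charts_at A (x t)
                             then vector_derivative (\<lambda>y. coords c (X (t, y))) (at y0) else 0)"
      using var unfolding variation_vector_def by blast
    obtain c where cA: "c \<in> A" "x t \<in> dom_chart c"
      using assms(1) unfolding smooth_atlas_def by blast
    let ?W = "{z \<in> W. X z \<in> dom_chart c}"
    have "(t, y0) \<in> ?W" using cA t WI XV by auto
    \<comment> \<open>The members of the family may live on different intervals. A rectangle around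
      \<open>(t, y0)\<close> that stays in one chart gives all nearby members a common time
      interval.\<close>
    then obtain J K where "open J" "open K" "(t, y0) \<in> J \<times> K" and JK: "J \<times> K \<subseteq> ?W"
      by (rule open_prod_elim[OF open_chart_preimage[OF assms(1) fam cA(1)]])
    then have "open J" "t \<in> J" "open K" "y0 \<in> K" by auto
    obtain e where e: "e > 0" "ball t e \<subseteq> J" using \<open>open J\<close> \<open>t \<in> J\<close> open_contains_ball by blast
    obtain k where k: "k > 0" "ball y0 k \<subseteq> K" using \<open>open K\<close> \<open>y0 \<in> K\<close> open_contains_ball by blast
    let ?J = "{t - e<..<t + e}" and ?K = "{y0 - k<..<y0 + k}"
    have box: "(s, y) \<in> W \<and> X (s, y) \<in> dom_chart c" if "s \<in> ?J" "y \<in> ?K" for s y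
      using that e(2) k(2) JK unfolding ball_eq_greaterThanLessThan by blast
    have tJ: "t \<in> ?J" and yK: "y0 \<in> ?K" using e k by auto
    define z where "z = (\<lambda>p. (coords c (X p), V p c))"
    define l where "l = local_lagrangian A L c"
    define px where "px = (\<lambda>q. \<chi> i. frechet_derivative l (at q) (axis i 1, 0))"
    define pv where "pv = (\<lambda>q. \<chi> i. frechet_derivative l (at q) (0, axis i 1))"
    define om where "om = (\<lambda>q. pv q \<bullet> snd q)"
    have pv: "dL_dv A L c (X p, V p) = pv (z p)" and px: "dL_dx A L c (X p, V p) = px (z p)" for p
      by (simp_all add: dL_dv_def dL_dx_def pv_def px_def z_def l_def)
    have tr: "V (s, y) \<in> tangent_space A (X (s, y))" "V (s, y) \<noteq> (\<lambda>_. 0)" "c \<in> charts_at A (X (s, y))" 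
      "((\<lambda>s. coords c (X (s, y))) has_vector_derivative
           (1 / Omega A L (X (s, y), V (s, y))) *\<^sub>R V (s, y) c) (at s)" 
      "((\<lambda>s. dL_dv A L c (X (s, y), V (s, y))) has_vector_derivative
           (1 / Omega A L (X (s, y), V (s, y))) *\<^sub>R dL_dx A L c (X (s, y), V (s, y))) (at s)" 
      if "s \<in> ?J" "y \<in> ?K" for s y
    proof -
      have "trajectory A L {t. (t, y) \<in> W} (\<lambda>t. X (t, y)) (\<lambda>t. V (t, y))"
        using fam unfolding trajectory_family_def by blast
      moreover have "s \<in> {t. (t, y) \<in> W}" "c \<in> charts_at A (X (s, y))"
        using box[OF that] cA(1) by (simp_all add: charts_at_def)
      ultimately show "V (s, y) \<in> tangent_space A (X (s, y))" "V (s, y) \<noteq> (\<lambda>_. 0)"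
        "c \<in> charts_at A (X (s, y))"
        "((\<lambda>s. coords c (X (s, y))) has_vector_derivative
           (1 / Omega A L (X (s, y), V (s, y))) *\<^sub>R V (s, y) c) (at s)"
        "((\<lambda>s. dL_dv A L c (X (s, y), V (s, y))) has_vector_derivative
           (1 / Omega A L (X (s, y), V (s, y))) *\<^sub>R dL_dx A L c (X (s, y), V (s, y))) (at s)"
        unfolding trajectory_def by blast+
    qed
    have Om: "Omega A L (X (s, y), V (s, y)) = om (z (s, y))" if "s \<in> ?J" "y \<in> ?K" for s y
      using Omega_eq_inner[OF assms(3) tr(1)[OF that] tr(3)[OF that]] 
      by (simp add: pv om_def) (simp add: z_def)
    have l: "smooth_on (image_chart (bundle_chart (tangent_bundle A) c)) l"
      using assms(2) cA(1) unfolding smooth_lagrangian_def l_def by blast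
    have z: "smooth_on (?J \<times> ?K) z"
    proof (rule smooth_on_subset)
      show "smooth_on ?W z"
        using fam cA(1) unfolding trajectory_family_def z_def by blast
      show "?J \<times> ?K \<subseteq> ?W"
        using box by blast
    qed
    have zS: "z (s, y) \<in> image_chart (bundle_chart (tangent_bundle A) c)" if "s \<in> ?J" "y \<in> ?K" for s y
    proof -
      have "(X (s, y), V (s, y)) \<in> dom_chart (bundle_chart (tangent_bundle A) c)"
        using tr(1)[OF that] box[OF that] by (simp add: bundle_chart_def tangent_bundle_def)
      moreover have "z (s, y) = coords (bundle_chart (tangent_bundle A) c) (X (s, y), V (s, y))"
        by (simp add: bundle_chart_def z_def)
      ultimately show ?thesis by (simp add: image_chart_def)
    qed
    \<comment> \<open>\<open>C\<close> belongs to the chosen rectangle, chart and family, hence may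
      vary with \<open>t\<close> and \<open>\<tau>\<close>. This is harmless: the equation to be
      proved is local, and \<open>C\<close> is eliminated between the first and second
      derivatives.\<close>
    obtain C where C: "\<And>s. s \<in> ?J \<Longrightarrow>
      ((\<lambda>s. pv (z (s, y0)) \<bullet> vector_derivative (\<lambda>y. fst (z (s, y))) (at y0))
        has_real_derivative - C / om (z (s, y0))) (at s)"
    proof (rule has_real_derivative_deviation[OF l z zS, of px pv om y0])
      fix s y assume sy: "s \<in> ?J" "y \<in> ?K"
      show "om (z (s, y)) > 0"
        using assms(5) tr(1,2)[OF sy] Om[OF sy] by metis
      show "((\<lambda>s. fst (z (s, y))) has_vector_derivative (1 / om (z (s, y))) *\<^sub>R snd (z (s, y))) (at s)"
        using tr(4)[OF sy] by (simp only: Om[OF sy]) (simp add: z_def)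
      show "((\<lambda>s. pv (z (s, y))) has_vector_derivative (1 / om (z (s, y))) *\<^sub>R px (z (s, y))) (at s)"
        using tr(5)[OF sy] by (simp only: Om[OF sy] pv px)
    qed (use yK in \<open>auto simp: px_def pv_def om_def\<close>)
    have JI: "s \<in> I" if "s \<in> ?J" for s using box[OF that yK] WI by blast
    \<comment> \<open>The coordinate expression has to agree with \<open>\<phi>\<close> on a whole
      neighbourhood of \<open>t\<close>, because \<open>\<phi>\<close> is differentiated
      twice.\<close>
    have phi_eq: "pv (z (s, y0)) \<bullet> vector_derivative (\<lambda>y. fst (z (s, y))) (at y0) = \<phi> s" 
      if s: "s \<in> ?J" for s
    proof -
      have "\<tau> s \<in> tangent_space A (x s)"
        using variation_in_tangent_space[OF assms(1) fam, of s y0] box[OF s yK] \<tau>[OF JI[OF s]] XV[OF JI[OF s]]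
        by simp
      then have "\<phi> s = dL_dv A L c (x s, v s) \<bullet> \<tau> s c"
        using pairing_momentum[OF assms(3), of "v s" "x s" "\<tau> s" c] tr[OF s yK] XV[OF JI[OF s]]
        by (simp add: \<phi> deviation_function_def)
      then show ?thesis
        using \<tau>[OF JI[OF s]] pv[of "(s, y0)"] XV[OF JI[OF s]] tr(3)[OF s yK] by (simp add: z_def)
    qed
    have Om0: "om (z (s, y0)) = ?Om s" if "s \<in> ?J" for s
      using Om[OF that yK] XV[OF JI[OF that]] by simp
    have d\<phi>: "(\<phi> has_real_derivative - C / ?Om s) (at s)" if "s \<in> ?J" for s
      using has_field_derivative_transform_within_open[OF C[OF that] _ that phi_eq] Om0[OF that] by simp
    have deriv\<phi>: "- C / ?Om s = deriv \<phi> s" if "s \<in> ?J" for s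
      using DERIV_imp_deriv[OF d\<phi>[OF that]] by simp
    have c_at: "c \<in> charts_at A (x t)" using cA by (simp add: charts_at_def)
    \<comment> \<open>In the chart \<open>Omega\<close> is the inner product of momentum and vector
      components, and a trajectory has both differentiable in time.\<close>
    have "(\<lambda>s. dL_dv A L c (x s, v s) \<bullet> v s c) differentiable (at t)"
      using traj t c_at unfolding trajectory_def
      by (intro differentiable_inner) (auto intro: differentiableI_vector)
    then obtain D where "((\<lambda>s. dL_dv A L c (x s, v s) \<bullet> v s c) has_real_derivative D) (at t)"
      using real_differentiable_def by blast
    then have D: "(?Om has_real_derivative D) (at t)"
    proof (rule has_field_derivative_transform_within_open[of _ _ _ ?J])
      fix s assume s: "s \<in> ?J"
      show "dL_dv A L c (x s, v s) \<bullet> v s c = ?Om s"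
        using Omega_eq_inner[OF assms(3) tr(1)[OF s yK] tr(3)[OF s yK]] XV[OF JI[OF s]] by simp
    qed (use tJ in auto)
    have pos: "?Om t > 0"
      using traj t assms(5) unfolding trajectory_def by blast
    \<comment> \<open>The result factors as \<open>(- D / ?Om t) * (- C / ?Om t)\<close>. The second
      factor is \<open>deriv \<phi> t\<close>, which absorbs \<open>C\<close>; the first is the
      coefficient sought.\<close>
    have "((\<lambda>s. - C / ?Om s) has_real_derivative C * D / (?Om t)\<^sup>2) (at t)"
      using D pos by (auto intro!: derivative_eq_intros simp: power2_eq_square)
    then have "(deriv \<phi> has_real_derivative C * D / (?Om t)\<^sup>2) (at t)"
      using has_field_derivative_transform_within_open[OF _ _ tJ deriv\<phi>] by simp
    moreover have "C * D / (?Om t)\<^sup>2 = (- deriv ?Om t / ?Om t) * deriv \<phi> t"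
      using DERIV_imp_deriv[OF D] pos by (simp flip: deriv\<phi>[OF tJ] add: power2_eq_square)
    ultimately show ?thesis
      using d\<phi>[OF tJ] real_differentiable_def by metis
  qed
  show ?thesis
    unfolding weak_normality_def
  proof (intro allI impI)
    fix I x v assume traj: "trajectory A L I x v"
    show "\<exists>\<A> \<B> :: real \<Rightarrow> real. \<forall>\<tau>. variation_vector A L I x v \<tau> \<longrightarrow>
           (let \<phi> = deviation_function A L x v \<tau> in
            \<forall>t\<in>I. \<phi> differentiable (at t) \<and>
                  (deriv \<phi> has_real_derivative \<A> t * deriv \<phi> t + \<B> t * \<phi> t) (at t))"
      using normal[OF traj _ refl]
      by (intro exI[of _ "\<lambda>t. - deriv (\<lambda>s. Omega A L (x s, v s)) t / Omega A L (x t, v t)"]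
          exI[of _ "\<lambda>_. 0"]) (simp add: Let_def)
  qed
qed

end
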